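(* Let $n\geqslant 2$. Any knotted subgroup of $SO(n)$ is ambient automorphic to a knotted subgroup of $SO(n)$ of the block diagonal form $$\gamma(t)=\begin{pmatrix}\lambda_1(t)&&&&\\&\lambda_2(t)&&&\\&&\ddots&&\\&&&\lambda_\ell(t)&\\&&&&I_{n-2\ell}\end{pmatrix},\qquad \lambda_j(t)=\begin{pmatrix}\cos\lambda_j t&\sin\lambda_j t\\-\sin\lambda_j t&\cos\lambda_j t\end{pmatrix},$$ where $\lambda_1,\ldots,\lambda_\ell$ are non-zero real numbers.
   Context: $I_m$ denotes the $m\times m$ identity matrix. A knotted subgroup of a Lie group $G$ is a continuous injective group homomorphism $\gamma:S^1\to G$ with continuous inverse (defined on its image); its image is also called a knotted subgroup. Here $S^1\cong\mathbb{R}/2\pi\mathbb{Z}$, and the argument of $\gamma$ is written as $t$ (mod $2\pi$). Given knotted subgroups $\phi_1,\phi_2:S^1\to G$, an ambient automorphism from $\phi_1$ to $\phi_2$ is a continuous map $F:G\times[0,1]\to G$ such that, writing $F_t(A):=F(A,t)$: $F_0$ is the identity map on $G$; $F_t$ is both a homeomorphism and a group automorphism of $G$ for all $t\in[0,1]$; and $F_1\circ\phi_1=\phi_2$. In this case $\phi_1$ is said to be ambient automorphic to $\phi_2$. *)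

theory Defs
  imports "HOL-Analysis.Analysis" "HOL-Algebra.Group"
begin

text \<open>
  The circle \<open>\<real>/2\<pi>\<int>\<close> is represented by the unit circle in the complex plane, the class of \<open>t\<close>
  corresponding to \<open>cis t\<close>.
\<close>

definition circle_group :: "complex monoid" where
  "circle_group = \<lparr>carrier = sphere 0 1, mult = (*), one = 1\<rparr>"

definition SO_group :: "(real^'n^'n) monoid" where
  "SO_group = \<lparr>carrier = {A. orthogonal_matrix A \<and> det A = 1}, mult = (**), one = mat 1\<rparr>"

text \<open>
  A topological (in particular, a Lie) group is given by a group structure whose carrier has the
  subspace topology of the ambient type; for \<^const>\<open>SO_group\<close> this is the Euclidean topology on
  matrices.  Maps are only constrained on the respective carriers.
\<close>

definition knotted_subgroup :: "('a::topological_space) monoid \<Rightarrow> (complex \<Rightarrow> 'a) \<Rightarrow> bool" where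
  "knotted_subgroup G \<gamma> \<longleftrightarrow>
     \<gamma> \<in> hom circle_group G \<and>
     continuous_on (carrier circle_group) \<gamma> \<and>
     inj_on \<gamma> (carrier circle_group) \<and>
     continuous_on (\<gamma> ` carrier circle_group) (inv_into (carrier circle_group) \<gamma>)"

definition ambient_automorphism ::
    "('a::topological_space) monoid \<Rightarrow> (complex \<Rightarrow> 'a) \<Rightarrow> (complex \<Rightarrow> 'a) \<Rightarrow> ('a \<times> real \<Rightarrow> 'a) \<Rightarrow> bool"
  where
  "ambient_automorphism G \<phi>\<^sub>1 \<phi>\<^sub>2 F \<longleftrightarrow>
     continuous_on (carrier G \<times> {0..1}) F \<and>
     F \<in> carrier G \<times> {0..1} \<rightarrow> carrier G \<and>
     (\<forall>A\<in>carrier G. F (A, 0) = A) \<and>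
     (\<forall>t\<in>{0..1}. (\<exists>g. homeomorphism (carrier G) (carrier G) (\<lambda>A. F (A, t)) g) \<and>
                 (\<lambda>A. F (A, t)) \<in> iso G G) \<and>
     (\<forall>z\<in>carrier circle_group. F (\<phi>\<^sub>1 z, 1) = \<phi>\<^sub>2 z)"

definition ambient_automorphic ::
    "('a::topological_space) monoid \<Rightarrow> (complex \<Rightarrow> 'a) \<Rightarrow> (complex \<Rightarrow> 'a) \<Rightarrow> bool" where
  "ambient_automorphic G \<phi>\<^sub>1 \<phi>\<^sub>2 \<longleftrightarrow>
     knotted_subgroup G \<phi>\<^sub>1 \<and> knotted_subgroup G \<phi>\<^sub>2 \<and> (\<exists>F. ambient_automorphism G \<phi>\<^sub>1 \<phi>\<^sub>2 F)"

text \<open>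
  Row and column numbers are 0-based: the \<open>j\<close>-th block occupies the positions \<open>2 * j\<close> and
  \<open>2 * j + 1\<close>.  The entries of a single block are indexed by the parities of these positions.
\<close>

definition rotation_entry :: "real \<Rightarrow> nat \<Rightarrow> nat \<Rightarrow> real" where
  "rotation_entry \<theta> a b = (if a = b then cos \<theta> else if a < b then sin \<theta> else - sin \<theta>)"

definition block_entry :: "nat \<Rightarrow> (nat \<Rightarrow> real) \<Rightarrow> real \<Rightarrow> nat \<Rightarrow> nat \<Rightarrow> real" where
  "block_entry l lam t r s =
     (if r < 2 * l \<and> s < 2 * l
      then (if r div 2 = s div 2 then rotation_entry (lam (r div 2) * t) (r mod 2) (s mod 2) else 0)
      else (if r = s then 1 else 0))"

text \<open>
  Since the index type \<open>'n\<close> carries no order, the position of each index among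
  \<open>0, \<dots>, CARD('n) - 1\<close> is given by a numbering \<open>pos\<close>.
\<close>

definition block_diagonal :: "('n \<Rightarrow> nat) \<Rightarrow> nat \<Rightarrow> (nat \<Rightarrow> real) \<Rightarrow> real \<Rightarrow> real^'n^'n" where
  "block_diagonal pos l lam t = (\<chi> i j. block_entry l lam t (pos i) (pos j))"

lemma group_circle_group: "group circle_group"
proof (rule groupI)
  fix x assume "x \<in> carrier circle_group"
  then show "\<exists>y\<in>carrier circle_group. y \<otimes>\<^bsub>circle_group\<^esub> x = \<one>\<^bsub>circle_group\<^esub>"
    by (intro bexI[of _ "inverse x"]) (auto simp: circle_group_def norm_inverse intro!: left_inverse)
qed (auto simp: circle_group_def norm_mult)

lemma group_SO_group: "group (SO_group :: (real^'n^'n) monoid)"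
proof (rule groupI)
  fix A :: "real^'n^'n" assume "A \<in> carrier SO_group"
  then show "\<exists>B\<in>carrier SO_group. B \<otimes>\<^bsub>SO_group\<^esub> A = \<one>\<^bsub>SO_group\<^esub>"
    by (intro bexI[of _ "transpose A"]) (auto simp: SO_group_def orthogonal_matrix_def)
qed (auto simp: SO_group_def orthogonal_matrix_mul orthogonal_matrix_id det_mul matrix_mul_assoc)

end

theory Submission
  imports Defs
begin

text \<open>
  Lifting the knotted subgroup \<open>\<phi>\<close> to the line gives a continuous one-parameter group
  \<open>A t = \<phi> (cis t)\<close> of orthogonal matrices.  Such a group is automatically differentiable, with
  \<open>A' = A X\<close> for a constant matrix \<open>X\<close> (\<open>one_parameter_group_generator\<close>), and orthogonality of all
  \<open>A t\<close> makes \<open>X\<close> skew.  A skew matrix splits \<open>\<real>\<^sup>n\<close> orthogonally into its kernel and planes on which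
  it acts as a multiple of the quarter turn (\<open>skew_matrix_normal_form\<close>); on each such plane \<open>A t\<close> is
  the rotation by the angle \<open>\<lambda>\<^sub>j t\<close>, and on the kernel it is the identity.  So conjugation by the
  orthogonal matrix \<open>P\<close> whose columns form an adapted basis brings \<open>A\<close> into block diagonal form.
  Injectivity of \<open>\<phi>\<close> guarantees that there is at least one block.

  The ambient automorphism is conjugation by a path of orthogonal matrices from the identity to \<open>P\<close>.
  It exists if \<open>P\<close> lies in the identity component of \<open>O(n)\<close>.  Writing an orthogonal matrix as a product
  of reflections, and moving all mirrors to one fixed mirror, shows that every \<open>P\<close> is joined either
  to the identity or to that single reflection (\<open>orthogonal_matrix_components\<close>).  In the second case
  the sign of one vector of the first rotation plane is changed; this moves \<open>P\<close> into the identity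
  component and only replaces \<open>\<lambda>\<^sub>0\<close> by \<open>- \<lambda>\<^sub>0\<close>.  Conjugation by an arbitrary orthogonal matrix
  is an automorphism of \<open>SO(n)\<close>, so paths in \<open>O(n)\<close> suffice.
\<close>

section \<open>Matrix multiplication as a bounded bilinear map\<close>

lemma bounded_bilinear_matrix_mult:
  "bounded_bilinear ((**) :: real^'n^'n \<Rightarrow> real^'n^'n \<Rightarrow> real^'n^'n)"
proof -
  have "bilinear ((**) :: real^'n^'n \<Rightarrow> real^'n^'n \<Rightarrow> real^'n^'n)"
    by (simp add: bilinear_def linear_iff matrix_matrix_mult_def vec_eq_iff sum.distrib sum_distrib_left
        algebra_simps)
  then show ?thesis by (simp add: bilinear_conv_bounded_bilinear)
qed

lemma bounded_bilinear_matrix_vector_mult: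
  "bounded_bilinear ((*v) :: real^'n^'n \<Rightarrow> real^'n \<Rightarrow> real^'n)"
proof -
  have "bilinear ((*v) :: real^'n^'n \<Rightarrow> real^'n \<Rightarrow> real^'n)"
    by (simp add: bilinear_def linear_iff matrix_vector_mult_def vec_eq_iff sum.distrib sum_distrib_left
        algebra_simps)
  then show ?thesis by (simp add: bilinear_conv_bounded_bilinear)
qed

lemma continuous_on_transpose:
  fixes f :: "'a::topological_space \<Rightarrow> real^'n^'n"
  assumes "continuous_on S f"
  shows "continuous_on S (\<lambda>x. transpose (f x))"
  unfolding transpose_def by (intro continuous_intros assms)

lemma tendsto_det:
  fixes f :: "'a \<Rightarrow> real^'n^'n"
  assumes "(f \<longlongrightarrow> A) F"
  shows "((\<lambda>x. det (f x)) \<longlongrightarrow> det A) F"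
  unfolding det_def by (intro tendsto_intros assms)

lemma matrix_eq_on_axes:
  fixes A B :: "real^'n^'n"
  assumes "\<And>k. A *v axis k 1 = B *v axis k 1"
  shows "A = B"
  using assms by (simp add: matrix_vector_mult_basis column_def vec_eq_iff)

lemma orthogonal_matrix_inner:
  fixes Q :: "real^'n^'n"
  assumes "orthogonal_matrix Q"
  shows "(Q *v x) \<bullet> (Q *v y) = x \<bullet> y"
proof -
  have "orthogonal_transformation ((*v) Q)"
    using assms by (simp add: orthogonal_transformation_matrix)
  then show ?thesis by (simp add: orthogonal_transformation_def)
qed

section \<open>The generator of a one-parameter group of matrices\<close>

lemma has_vector_derivative_shift:
  fixes f :: "real \<Rightarrow> 'a::real_normed_vector"
  assumes "(f has_vector_derivative D) (at (x + c))"
  shows "((\<lambda>t. f (t + c)) has_vector_derivative D) (at x)"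
proof -
  have "((\<lambda>t. t + c) has_vector_derivative 1) (at x)"
    by (auto intro!: derivative_eq_intros)
  then show ?thesis
    using vector_diff_chain_at[of "\<lambda>t. t + c" 1 x f D] assms by (simp add: o_def)
qed

text \<open>
  Averaging makes a continuous group smooth.  If \<open>B\<close> is the integral of \<open>A\<close> over \<open>[0, u]\<close>, then
  \<open>A t B\<close> is the integral of \<open>A\<close> over \<open>[t, t + u]\<close>, a differentiable function of \<open>t\<close>.  For small \<open>u\<close>
  the mean value \<open>B / u\<close> is near \<open>A 0 = 1\<close>, so \<open>B\<close> can be cancelled.
\<close>

lemma one_parameter_group_differentiable_at_0:
  fixes A :: "real \<Rightarrow> real^'n^'n"
  assumes cont: "continuous_on UNIV A"
    and add: "\<And>s t. A (s + t) = A s ** A t"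
    and zero: "A 0 = mat 1"
  obtains X where "(A has_vector_derivative X) (at 0)"
proof -
  \<comment> \<open>An antiderivative of \<open>A\<close> near every point of \<open>[-1, 2]\<close>, where \<open>t\<close> and \<open>t + u\<close> will lie.\<close>
  define G where "G = (\<lambda>x. integral {-2..x} A)"
  have int: "A integrable_on {a..b}" for a b
    by (rule integrable_continuous_real) (rule continuous_on_subset[OF cont], simp)
  have G: "(G has_vector_derivative A x) (at x)" if "-2 < x" "x < 3" for x
  proof -
    have "(G has_vector_derivative A x) (at x within {-2..3})"
      unfolding G_def using that
      by (intro integral_has_vector_derivative continuous_on_subset[OF cont]) auto
    moreover have "x \<in> interior {-2..3}" using that by simp
    ultimately show ?thesis by (simp only: at_within_interior)
  qed
  \<comment> \<open>The mean value of \<open>A\<close> over \<open>[0, u]\<close>.\<close>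
  define Q where "Q = (\<lambda>u. (1 / u) *\<^sub>R (G u - G 0))"
  have "(Q \<longlongrightarrow> mat 1) (at 0)"
  proof -
    have "((\<lambda>u. norm (G u - G 0 - u *\<^sub>R mat 1) / norm u) \<longlongrightarrow> 0) (at 0)"
      using G[of 0] by (simp add: has_vector_derivative_def has_derivative_at zero)
    moreover have "\<forall>\<^sub>F u in at 0. norm (G u - G 0 - u *\<^sub>R mat 1) / norm u = norm (Q u - mat 1)"
      unfolding eventually_at_filter
    proof (intro always_eventually allI impI)
      fix u :: real assume "u \<noteq> 0"
      then have "Q u - mat 1 = (1 / u) *\<^sub>R (G u - G 0 - u *\<^sub>R mat 1)"
        by (simp add: Q_def algebra_simps)
      then show "norm (G u - G 0 - u *\<^sub>R mat 1) / norm u = norm (Q u - mat 1)"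
        by simp
    qed
    ultimately have "((\<lambda>u. norm (Q u - mat 1)) \<longlongrightarrow> 0) (at 0)"
      using tendsto_cong by force
    then show ?thesis by (simp add: tendsto_norm_zero_iff LIM_zero_iff)
  qed
  then have "((\<lambda>u. det (Q u)) \<longlongrightarrow> 1) (at 0)"
    by (metis det_I tendsto_det)
  then have "eventually (\<lambda>u. det (Q u) > 0) (at 0)"
    by (rule order_tendstoD) simp
  then obtain d where d: "d > 0" "\<And>u. u \<noteq> 0 \<Longrightarrow> \<bar>u\<bar> < d \<Longrightarrow> det (Q u) > 0"
    by (auto simp: eventually_at dist_real_def)
  define u where "u = min (d / 2) 1"
  have u: "0 < u" "u \<le> 1" "u < d" using d(1) by (auto simp: u_def)
  define B where "B = G u - G 0"
  have "det (Q u) \<noteq> 0" using d(2)[of u] u by simp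
  then have "invertible (Q u)" by (simp add: invertible_det_nz)
  then obtain C' where "Q u ** C' = mat 1" by (auto simp: invertible_def)
  then have BC: "B ** ((1/u) *\<^sub>R C') = mat 1"
    by (simp add: Q_def B_def bounded_bilinear.scaleR_left[OF bounded_bilinear_matrix_mult]
          bounded_bilinear.scaleR_right[OF bounded_bilinear_matrix_mult])
  define C where "C = (1/u) *\<^sub>R C'"
  have BG: "B = integral {0..u} A"
    using Henstock_Kurzweil_Integration.integral_combine[of "-2" 0 u A] int u by (simp add: B_def G_def algebra_simps)
  have AB: "A t ** B = G (t + u) - G t" if "\<bar>t\<bar> < 1" for t
  proof -
    have "A t ** B = integral {0..u} (\<lambda>s. A t ** A s)"
      unfolding BG using integral_linear[OF int bounded_bilinear.bounded_linear_right[OF bounded_bilinear_matrix_mult], of 0 u "A t"]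
      by (simp add: o_def)
    also have "\<dots> = integral (cbox 0 u) (A \<circ> (+) t)" by (simp add: add o_def)
    also have "\<dots> = integral {t..t+u} A"
      by (subst integral_shift_cbox_plus) (simp add: add.commute)
    also have "\<dots> = G (t + u) - G t"
      using Henstock_Kurzweil_Integration.integral_combine[of "-2" t "t+u" A] int u that by (simp add: G_def algebra_simps)
    finally show ?thesis .
  qed
  have "((\<lambda>t. G (t + u) - G t) has_vector_derivative (A u - A 0)) (at 0)"
  proof -
    have "((\<lambda>t. G (t + u)) has_vector_derivative A u) (at 0)"
      using has_vector_derivative_shift[of G "A u" 0 u] G[of u] u by simp
    then show ?thesis using G[of 0] by (auto intro!: derivative_eq_intros)
  qed
  then have "((\<lambda>t. (G (t + u) - G t) ** C) has_vector_derivative (A u - A 0) ** C) (at 0)"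
    by (rule bounded_linear.has_vector_derivative[OF bounded_bilinear.bounded_linear_left[OF bounded_bilinear_matrix_mult]])
  then have "(A has_vector_derivative (A u - A 0) ** C) (at 0)"
  proof (rule has_vector_derivative_transform_within_open[of _ _ _ "{-1<..<1}"])
    show "(G (t + u) - G t) ** C = A t" if "t \<in> {-1<..<1}" for t
    proof -
      have "\<bar>t\<bar> < 1" using that by auto
      then have "(G (t + u) - G t) ** C = A t ** (B ** C)"
        by (simp only: AB[symmetric] matrix_mul_assoc)
      then show ?thesis by (simp add: BC C_def)
    qed
  qed auto
  then show thesis by (rule that)
qed

lemma one_parameter_group_generator:
  fixes A :: "real \<Rightarrow> real^'n^'n"
  assumes cont: "continuous_on UNIV A"
    and add: "\<And>s t. A (s + t) = A s ** A t"
    and zero: "A 0 = mat 1"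
  obtains X where "\<And>t. (A has_vector_derivative A t ** X) (at t)"
proof -
  obtain X where X: "(A has_vector_derivative X) (at 0)"
    using one_parameter_group_differentiable_at_0[OF assms] by blast
  have "(A has_vector_derivative A t ** X) (at t)" for t
  proof -
    have "((\<lambda>s. A (s - t)) has_vector_derivative X) (at t)"
      using has_vector_derivative_shift[of A X t "- t"] X by simp
    then have "((\<lambda>s. A t ** A (s - t)) has_vector_derivative A t ** X) (at t)"
      by (rule bounded_linear.has_vector_derivative[OF bounded_bilinear.bounded_linear_right[OF bounded_bilinear_matrix_mult]])
    then show ?thesis by (simp flip: add)
  qed
  then show thesis by (rule that)
qed

text \<open>
  Differentiating \<open>A t x \<bullet> A t y = x \<bullet> y\<close> at \<open>t = 0\<close>.
\<close>

lemma generator_skew: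
  fixes A :: "real \<Rightarrow> real^'n^'n"
  assumes der: "\<And>t. (A has_vector_derivative A t ** X) (at t)"
    and zero: "A 0 = mat 1"
    and orth: "\<And>t. orthogonal_matrix (A t)"
  shows "(X *v x) \<bullet> y = - (x \<bullet> (X *v y))"
proof -
  have d: "((\<lambda>t. A t *v z) has_vector_derivative X *v z) (at 0)" for z
    using bounded_linear.has_vector_derivative[OF bounded_bilinear.bounded_linear_left[OF bounded_bilinear_matrix_vector_mult] der[of 0], of z]
    by (simp add: zero)
  have "((\<lambda>t. (A t *v x) \<bullet> (A t *v y)) has_vector_derivative
      (A 0 *v x) \<bullet> (X *v y) + (X *v x) \<bullet> (A 0 *v y)) (at 0)"
    by (rule bounded_bilinear.has_vector_derivative[OF bounded_bilinear_inner d d])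
  moreover have "(A t *v x) \<bullet> (A t *v y) = x \<bullet> y" for t
    by (rule orthogonal_matrix_inner[OF orth])
  ultimately have "x \<bullet> (X *v y) + (X *v x) \<bullet> y = 0"
    by (simp add: zero vector_derivative_unique_at[OF _ has_vector_derivative_const])
  then show ?thesis by simp
qed

text \<open>
  The rotated vectors solve the linear differential equation that \<open>A\<close> satisfies: undoing the
  expected rotation inside the argument of \<open>A t\<close> gives a curve with zero derivative.  The case
  \<open>c = 0\<close>, \<open>v = 0\<close> says that \<open>A t\<close> fixes the kernel of \<open>X\<close>.
\<close>

lemma one_parameter_group_rotates_plane:
  fixes A :: "real \<Rightarrow> real^'n^'n"
  assumes der: "\<And>t. (A has_vector_derivative A t ** X) (at t)"
    and zero: "A 0 = mat 1"
    and u: "X *v u = - (c *\<^sub>R v)" and v: "X *v v = c *\<^sub>R u"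
  shows "A t *v u = cos (c * t) *\<^sub>R u - sin (c * t) *\<^sub>R v"
    and "A t *v v = sin (c * t) *\<^sub>R u + cos (c * t) *\<^sub>R v"
proof -
  have X: "X *v (a *\<^sub>R u + b *\<^sub>R v) = (c * b) *\<^sub>R u - (c * a) *\<^sub>R v" for a b
    by (simp add: matrix_vector_right_distrib matrix_vector_mult_scaleR u v algebra_simps)
  \<comment> \<open>Curves \<open>a u + b v\<close> that solve \<open>w' = - X w\<close> are sent by \<open>A\<close> to constant curves.\<close>
  have const: "A t *v (a t *\<^sub>R u + b t *\<^sub>R v) = a 0 *\<^sub>R u + b 0 *\<^sub>R v"
    if a: "\<And>t. (a has_real_derivative - (c * b t)) (at t)"
      and b: "\<And>t. (b has_real_derivative c * a t) (at t)" for a b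
  proof -
    let ?w = "\<lambda>t. a t *\<^sub>R u + b t *\<^sub>R v"
    have w: "(?w has_vector_derivative - (c * b t) *\<^sub>R u + (c * a t) *\<^sub>R v) (at t)" for t
      by (rule derivative_eq_intros a b refl)+ simp
    have "((\<lambda>t. A t *v ?w t) has_vector_derivative 0) (at t)" for t
      using bounded_bilinear.has_vector_derivative[OF bounded_bilinear_matrix_vector_mult der w, of t]
      by (simp add: matrix_vector_mul_assoc[symmetric] X flip: matrix_vector_right_distrib)
    then obtain d where "\<And>t. A t *v ?w t = d"
      using has_vector_derivative_zero_constant[of UNIV "\<lambda>t. A t *v ?w t"] by auto
    from this[of t] this[of 0] have "A t *v ?w t = A 0 *v ?w 0" by simp
    then show ?thesis by (simp add: zero)
  qed
  let ?C = "cos (c * t)" and ?S = "sin (c * t)"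
  have cos: "((\<lambda>t. cos (c * t)) has_real_derivative - (c * sin (c * s))) (at s)"
    and sin: "((\<lambda>t. sin (c * t)) has_real_derivative c * cos (c * s)) (at s)" for s
    by (auto intro!: derivative_eq_intros)
  have 1: "A t *v (?C *\<^sub>R u + ?S *\<^sub>R v) = u"
    using const[OF cos sin] by simp
  have 2: "A t *v ((- ?S) *\<^sub>R u + ?C *\<^sub>R v) = v"
    using const[of "\<lambda>t. - sin (c * t)" "\<lambda>t. cos (c * t)"] cos DERIV_minus[OF sin] by simp
  have sq: "?C * ?C + ?S * ?S = 1" by (simp flip: power2_eq_square)
  have "u = ?C *\<^sub>R (?C *\<^sub>R u + ?S *\<^sub>R v) - ?S *\<^sub>R ((- ?S) *\<^sub>R u + ?C *\<^sub>R v)"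
    using sq by (simp add: algebra_simps flip: scaleR_add_left)
  then have "A t *v u = ?C *\<^sub>R (A t *v (?C *\<^sub>R u + ?S *\<^sub>R v)) - ?S *\<^sub>R (A t *v ((- ?S) *\<^sub>R u + ?C *\<^sub>R v))"
    by (metis matrix_vector_mult_diff_distrib matrix_vector_mult_scaleR)
  then show "A t *v u = ?C *\<^sub>R u - ?S *\<^sub>R v"
    unfolding 1 2 .
  have "v = ?S *\<^sub>R (?C *\<^sub>R u + ?S *\<^sub>R v) + ?C *\<^sub>R ((- ?S) *\<^sub>R u + ?C *\<^sub>R v)"
    using sq by (simp add: algebra_simps flip: scaleR_add_left)
  then have "A t *v v = ?S *\<^sub>R (A t *v (?C *\<^sub>R u + ?S *\<^sub>R v)) + ?C *\<^sub>R (A t *v ((- ?S) *\<^sub>R u + ?C *\<^sub>R v))"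
    by (metis matrix_vector_right_distrib matrix_vector_mult_scaleR)
  then show "A t *v v = ?S *\<^sub>R u + ?C *\<^sub>R v"
    unfolding 1 2 .
qed

section \<open>Normal form of a skew-symmetric matrix\<close>

definition orthonormal_upto :: "nat \<Rightarrow> (nat \<Rightarrow> 'a::real_inner) \<Rightarrow> bool" where
  "orthonormal_upto m f \<longleftrightarrow> (\<forall>i<m. \<forall>j<m. f i \<bullet> f j = (if i = j then 1 else 0))"

lemma orthonormal_upto_le_DIM:
  fixes f :: "nat \<Rightarrow> 'a::euclidean_space"
  assumes "orthonormal_upto m f"
  shows "m \<le> DIM('a)"
proof -
  have inj: "inj_on f {..<m}"
    using assms by (intro inj_onI) (metis lessThan_iff orthonormal_upto_def zero_neq_one)
  have "pairwise orthogonal (f ` {..<m})" "0 \<notin> f ` {..<m}"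
    using assms by (auto simp: pairwise_def orthogonal_def orthonormal_upto_def) (metis inner_zero_left zero_neq_one)
  then have "independent (f ` {..<m})" by (rule pairwise_orthogonal_independent)
  then have "card (f ` {..<m}) \<le> DIM('a)" by (simp add: independent_bound)
  then show ?thesis by (simp add: card_image[OF inj])
qed

lemma orthonormal_upto_Suc:
  assumes "orthonormal_upto m f" and "norm v = 1" and "\<And>i. i < m \<Longrightarrow> f i \<bullet> v = 0"
  shows "orthonormal_upto (Suc m) (f(m := v))"
  using assms by (auto simp: orthonormal_upto_def less_Suc_eq inner_commute norm_eq_1)

lemma orthonormal_upto_extend:
  fixes f :: "nat \<Rightarrow> 'a::euclidean_space"
  assumes "orthonormal_upto m f"
  obtains g where "orthonormal_upto DIM('a) g" and "\<And>i. i < m \<Longrightarrow> g i = f i"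
proof -
  have "\<exists>g. orthonormal_upto k g \<and> (\<forall>i<m. g i = f i)" if "m \<le> k" "k \<le> DIM('a)" for k
    using that
  proof (induction k rule: dec_induct)
    case base
    then show ?case using assms by auto
  next
    case (step k)
    then obtain g where g: "orthonormal_upto k g" "\<forall>i<m. g i = f i" by auto
    have "dim (g ` {..<k}) \<le> card (g ` {..<k})" by (simp add: dim_le_card')
    also have "\<dots> \<le> k" using card_image_le[of "{..<k}" g] by simp
    finally have "dim (g ` {..<k}) < DIM('a)" using step by simp
    from orthogonal_to_subspace_exists[OF this] obtain x
      where x: "x \<noteq> 0" "\<And>y. y \<in> span (g ` {..<k}) \<Longrightarrow> orthogonal x y" by blast
    have "g i \<bullet> (x /\<^sub>R norm x) = 0" if "i < k" for i
      using x(2)[of "g i"] that by (simp add: orthogonal_def inner_commute span_base)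
    then have "orthonormal_upto (Suc k) (g(k := x /\<^sub>R norm x))"
      using orthonormal_upto_Suc[OF g(1)] x(1) by simp
    moreover have "\<forall>i<m. (g(k := x /\<^sub>R norm x)) i = f i" using g(2) step by auto
    ultimately show ?case by blast
  qed
  from this[of "DIM('a)"] orthonormal_upto_le_DIM[OF assms] that show thesis by blast
qed

text \<open>
  The vectors \<open>f (2 * j)\<close> and \<open>f (2 * j + 1)\<close> play the roles of \<open>u\<close> and \<open>v\<close> above.  The signs
  are those for which \<open>A t\<close> acts by a block with \<open>+ sin\<close> in its upper right corner.
\<close>

definition rotation_pairs :: "real^'n^'n \<Rightarrow> nat \<Rightarrow> (nat \<Rightarrow> real) \<Rightarrow> (nat \<Rightarrow> real^'n) \<Rightarrow> bool" where
  "rotation_pairs X l lam f \<longleftrightarrow>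
     (\<forall>j<l. lam j \<noteq> 0 \<and> X *v f (2 * j) = - (lam j *\<^sub>R f (2 * j + 1)) \<and>
            X *v f (2 * j + 1) = lam j *\<^sub>R f (2 * j))"

text \<open>
  Take \<open>u\<close> to maximise \<open>\<bar>X x\<bar>\<^sup>2\<close> on the unit sphere of \<open>W\<close>, with maximum \<open>\<mu>\<close>.  The first variation
  at \<open>u\<close> vanishes, which for skew \<open>X\<close> says \<open>X\<^sup>2 u = - \<mu> u\<close>; then \<open>u\<close> and \<open>X u\<close> span the plane.
\<close>

lemma skew_matrix_eigenplane:
  fixes X :: "real^'n^'n"
  assumes skew: "\<And>x y. (X *v x) \<bullet> y = - (x \<bullet> (X *v y))"
    and W: "subspace W" and inv: "\<And>w. w \<in> W \<Longrightarrow> X *v w \<in> W"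
    and nz: "w0 \<in> W" "X *v w0 \<noteq> 0"
  obtains c u v where "u \<in> W" "v \<in> W" "c \<noteq> 0" "norm u = 1" "norm v = 1" "u \<bullet> v = 0"
    "X *v u = - (c *\<^sub>R v)" "X *v v = c *\<^sub>R u"
proof -
  let ?q = "\<lambda>x. (X *v x) \<bullet> (X *v x)"
  let ?S = "sphere 0 1 \<inter> W"
  have "compact ?S" by (intro compact_Int_closed closed_subspace W compact_sphere)
  moreover have "w0 \<noteq> 0" using nz(2) by auto
  then have w0: "w0 /\<^sub>R norm w0 \<in> ?S" using nz(1) W by (simp add: subspace_scale)
  then have "?S \<noteq> {}" by blast
  moreover have "continuous_on ?S ?q" by (intro continuous_intros)
  ultimately obtain u where u: "u \<in> ?S" "\<And>x. x \<in> ?S \<Longrightarrow> ?q x \<le> ?q u"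
    using continuous_attains_sup[of ?S ?q] by blast
  define \<mu> where "\<mu> = ?q u"
  have "?q (w0 /\<^sub>R norm w0) > 0"
    using nz(2) \<open>w0 \<noteq> 0\<close> by (simp add: matrix_vector_mult_scaleR)
  then have \<mu>: "\<mu> > 0" unfolding \<mu>_def using u(2)[OF w0] by (rule less_le_trans)
  define c where "c = sqrt \<mu>"
  have c: "c > 0" "c * c = \<mu>" using \<mu> by (auto simp: c_def)
  have uW: "u \<in> W" "u \<bullet> u = 1" using u(1) by (auto simp: norm_eq_1)
  have q_le: "?q x \<le> \<mu> * (x \<bullet> x)" if "x \<in> W" for x
  proof (cases "x = 0")
    case False
    then have "?q (x /\<^sub>R norm x) \<le> \<mu>"
      unfolding \<mu>_def using that W by (intro u(2)) (simp add: subspace_scale)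
    then show ?thesis using False
      by (simp add: matrix_vector_mult_scaleR field_simps power2_norm_eq_inner[symmetric] power2_eq_square)
  qed simp
  have var: "\<mu> * (u \<bullet> w) = (X *v u) \<bullet> (X *v w)" if w: "w \<in> W" for w
  proof -
    \<comment> \<open>\<open>\<mu> \<bar>x\<bar>\<^sup>2 - \<bar>X x\<bar>\<^sup>2\<close> is nonnegative on \<open>W\<close> and vanishes at \<open>u\<close>, so its derivative \<open>2 b\<close> in the direction \<open>w\<close> is zero.\<close>
    define b where "b = \<mu> * (u \<bullet> w) - (X *v u) \<bullet> (X *v w)"
    define k where "k = \<mu> * (w \<bullet> w) - ?q w"
    have ineq: "0 \<le> 2 * e * b + e^2 * k" for e
    proof -
      have "u + e *\<^sub>R w \<in> W" using uW w W by (simp add: subspace_add subspace_scale)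
      from q_le[OF this] show ?thesis
        using uW(2)
        by (simp add: \<mu>_def[symmetric] b_def k_def matrix_vector_right_distrib matrix_vector_mult_scaleR inner_simps
            inner_commute power2_eq_square algebra_simps)
    qed
    have "k \<ge> 0" using q_le[OF w] by (simp add: k_def)
    \<comment> \<open>The step \<open>e\<close> would minimise the right-hand side of \<open>ineq\<close> with \<open>k + 1\<close>, which cannot vanish, in place of \<open>k\<close>.\<close>
    define e where "e = - b / (k + 1)"
    have b_eq: "b = - e * (k + 1)" using \<open>k \<ge> 0\<close> by (simp add: e_def)
    have "0 \<le> (2 * e * b + e^2 * k) * (k + 1)^2"
      using ineq[of e] by (intro mult_nonneg_nonneg) auto
    also have "\<dots> = - (b^2 * (k + 2))"
      unfolding b_eq by algebra
    finally have "b^2 * (k + 2) \<le> 0" by simp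
    then have "b^2 \<le> 0" using \<open>k \<ge> 0\<close> by (simp add: mult_le_0_iff)
    then show ?thesis by (simp add: b_def)
  qed
  have XX: "X *v (X *v u) = - (\<mu> *\<^sub>R u)"
  proof -
    let ?z = "\<mu> *\<^sub>R u + X *v (X *v u)"
    have "?z \<in> W" using uW inv W by (simp add: subspace_add subspace_scale)
    then have "?z \<bullet> ?z = 0"
      using var[of ?z] skew[of "X *v u" ?z] by (simp add: inner_add_left)
    then show ?thesis by (simp add: eq_neg_iff_add_eq_0 add.commute)
  qed
  define v where "v = - ((1 / c) *\<^sub>R (X *v u))"
  show thesis
  proof (rule that)
    show "u \<in> W" "c \<noteq> 0" "norm u = 1" using uW c by (auto simp: norm_eq_1)
    show "v \<in> W" unfolding v_def using uW inv W by (simp add: subspace_neg subspace_scale)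
    have "v \<bullet> v = 1" using \<mu> c by (simp add: v_def \<mu>_def[symmetric] field_simps)
    then show "norm v = 1" by (simp add: norm_eq_1)
    show "u \<bullet> v = 0" using skew[of u u] by (simp add: v_def inner_commute)
    show "X *v u = - (c *\<^sub>R v)" using c by (simp add: v_def)
    show "X *v v = c *\<^sub>R u" using c
      by (simp add: v_def matrix_vector_mult_scaleR XX linear_neg[OF matrix_vector_mul_linear] field_simps flip: c(2))
  qed
qed

text \<open>
  Take a largest orthonormal family of rotation pairs.  Its orthogonal complement \<open>W\<close> is invariant
  under \<open>X\<close>, and \<open>X\<close> vanishes there, for otherwise an eigenplane in \<open>W\<close> would give a further
  pair.  Any orthonormal basis of \<open>W\<close> completes the family.
\<close>

lemma skew_matrix_normal_form:
  fixes X :: "real^'n^'n"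
  assumes skew: "\<And>x y. (X *v x) \<bullet> y = - (x \<bullet> (X *v y))"
  obtains l lam f where "2 * l \<le> CARD('n)" "orthonormal_upto CARD('n) f" "rotation_pairs X l lam f"
    "\<And>i. 2 * l \<le> i \<Longrightarrow> i < CARD('n) \<Longrightarrow> X *v f i = 0"
proof -
  define R where "R = (\<lambda>l. \<exists>lam f. orthonormal_upto (2 * l) f \<and> rotation_pairs X l lam f)"
  have R0: "R 0" by (simp add: R_def orthonormal_upto_def rotation_pairs_def)
  have bound: "2 * l \<le> CARD('n)" if "R l" for l
    using that orthonormal_upto_le_DIM[where 'a = "real^'n"] by (auto simp: R_def)
  have "\<exists>l. R l \<and> (\<forall>k. R k \<longrightarrow> k \<le> l)"
    by (rule Nat.ex_has_greatest_nat[where P = R and k = 0 and b = "CARD('n)", OF R0]) (use bound in fastforce)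
  then obtain l where l: "R l" "\<And>k. R k \<Longrightarrow> k \<le> l" by blast
  then obtain lam f where f: "orthonormal_upto (2 * l) f" "rotation_pairs X l lam f"
    by (auto simp: R_def)
  define W where "W = {w. \<forall>i<2*l. f i \<bullet> w = 0}"
  have W: "subspace W" by (auto simp: W_def subspace_def inner_add_right)
  have inv: "X *v w \<in> W" if "w \<in> W" for w
    unfolding W_def
  proof (intro CollectI allI impI)
    fix i assume i: "i < 2 * l"
    define j where "j = i div 2"
    have j: "j < l" "i = 2 * j \<or> i = 2 * j + 1" using i by (auto simp: j_def)
    then have "f (2 * j) \<bullet> w = 0" "f (2 * j + 1) \<bullet> w = 0"
      using that by (auto simp: W_def)
    then have "(X *v f i) \<bullet> w = 0" using j f(2) by (auto simp: rotation_pairs_def)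
    then show "f i \<bullet> (X *v w) = 0" using skew[of "f i" w] by simp
  qed
  have X0: "X *v w = 0" if "w \<in> W" for w
  proof (rule ccontr)
    assume "X *v w \<noteq> 0"
    from skew_matrix_eigenplane[OF skew W inv that this] obtain c u v where uv: "u \<in> W" "v \<in> W" "c \<noteq> 0" "norm u = 1" "norm v = 1"
      "u \<bullet> v = 0" "X *v u = - (c *\<^sub>R v)" "X *v v = c *\<^sub>R u" .
    let ?f = "f(2 * l := u, Suc (2 * l) := v)"
    have "orthonormal_upto (Suc (Suc (2 * l))) ?f"
      by (intro orthonormal_upto_Suc f) (use uv in \<open>auto simp: W_def less_Suc_eq\<close>)
    moreover have "rotation_pairs X (Suc l) (lam(l := c)) ?f"
      using f(2) uv by (auto simp: rotation_pairs_def less_Suc_eq)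
    ultimately have "R (Suc l)" by (auto simp: R_def)
    then show False using l(2)[of "Suc l"] by simp
  qed
  obtain g where g: "orthonormal_upto DIM(real^'n) g" "\<And>i. i < 2 * l \<Longrightarrow> g i = f i"
    using orthonormal_upto_extend[OF f(1)] by blast
  show thesis
  proof (rule that)
    show "2 * l \<le> CARD('n)" by (rule bound[OF l(1)])
    show o: "orthonormal_upto CARD('n) g" using g(1) by simp
    show "rotation_pairs X l lam g" using f(2) g(2) by (auto simp: rotation_pairs_def)
    show "X *v g i = 0" if "2 * l \<le> i" "i < CARD('n)" for i
    proof (rule X0)
      show "g i \<in> W" using that o bound[OF l(1)]
        by (auto simp: W_def orthonormal_upto_def simp flip: g(2))
    qed
  qed
qed

section \<open>Block diagonalisation of a one-parameter group\<close>

definition frame_matrix :: "('n \<Rightarrow> nat) \<Rightarrow> (nat \<Rightarrow> real^'n) \<Rightarrow> real^'n^'n" where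
  "frame_matrix pos f = (\<chi> i j. f (pos j) $ i)"

lemma frame_matrix_conj_entry:
  "(transpose (frame_matrix pos f) ** A ** frame_matrix pos f) $ i $ j = f (pos i) \<bullet> (A *v f (pos j))"
  apply (simp add: frame_matrix_def matrix_matrix_mult_def transpose_def matrix_vector_mult_def inner_vec_def sum_distrib_left sum_distrib_right mult_ac)
  by (rule sum.swap)

lemma orthogonal_frame_matrix:
  fixes pos :: "'n::finite \<Rightarrow> nat"
  assumes pos: "bij_betw pos UNIV {..<CARD('n)}" and f: "orthonormal_upto CARD('n) f"
  shows "orthogonal_matrix (frame_matrix pos f)"
proof -
  have "pos i < CARD('n)" "pos i = pos j \<longleftrightarrow> i = j" for i j
    using pos by (auto simp: bij_betw_def inj_on_def)
  then have "(transpose (frame_matrix pos f) ** frame_matrix pos f) $ i $ j = mat 1 $ i $ j" for i j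
    using frame_matrix_conj_entry[of pos f "mat 1" i j] f by (simp add: orthonormal_upto_def) (simp add: mat_def)
  then have "transpose (frame_matrix pos f) ** frame_matrix pos f = mat 1"
    by (simp add: vec_eq_iff)
  then show ?thesis by (simp add: orthogonal_matrix)
qed

text \<open>
  The entries of the conjugated matrix are \<open>f r \<bullet> A t (f s)\<close>, and \<open>A t (f s)\<close> involves only \<open>f s\<close>
  and its partner.
\<close>

lemma one_parameter_group_block_diagonal:
  fixes A :: "real \<Rightarrow> real^'n^'n" and pos :: "'n \<Rightarrow> nat"
  assumes pos: "bij_betw pos UNIV {..<CARD('n)}"
    and der: "\<And>t. (A has_vector_derivative A t ** X) (at t)"
    and zero: "A 0 = mat 1"
    and l: "2 * l \<le> CARD('n)" and f: "orthonormal_upto CARD('n) f"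
    and pairs: "rotation_pairs X l lam f"
    and ker: "\<And>i. 2 * l \<le> i \<Longrightarrow> i < CARD('n) \<Longrightarrow> X *v f i = 0"
  shows "transpose (frame_matrix pos f) ** A t ** frame_matrix pos f = block_diagonal pos l lam t"
proof -
  have "f r \<bullet> (A t *v f s) = block_entry l lam t r s" if r: "r < CARD('n)" and s: "s < CARD('n)" for r s
  proof (cases "s < 2 * l")
    case False
    then have "X *v f s = 0" using ker s by simp
    then have "A t *v f s = f s"
      using one_parameter_group_rotates_plane(1)[OF der zero, of "f s" 0 0 t] by simp
    then show ?thesis using f r s False by (simp add: orthonormal_upto_def block_entry_def)
  next
    case True
    define j where "j = s div 2"
    have j: "j < l" using True by (auto simp: j_def)
    have jn: "2 * j < CARD('n)" "2 * j + 1 < CARD('n)" using j l by auto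
    have Xu: "X *v f (2 * j) = - (lam j *\<^sub>R f (2 * j + 1))" and Xv: "X *v f (2 * j + 1) = lam j *\<^sub>R f (2 * j)"
      using pairs j by (auto simp: rotation_pairs_def)
    have fr: "f r \<bullet> f (2 * j) = (if r = 2 * j then 1 else 0)" "f r \<bullet> f (2 * j + 1) = (if r = 2 * j + 1 then 1 else 0)"
        "f r \<bullet> f (Suc (2 * j)) = (if r = 2 * j + 1 then 1 else 0)"
      using f r jn unfolding orthonormal_upto_def Suc_eq_plus1 by blast+
    note rot = one_parameter_group_rotates_plane[OF der zero Xu Xv, of t]
    have s': "s = 2 * j \<or> s = 2 * j + 1" by (auto simp: j_def)
    have r': "r = 2 * (r div 2) \<or> r = 2 * (r div 2) + 1" by auto
    show ?thesis
    proof (cases "r div 2 = j")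
      case True
      then have "r = 2 * j \<or> r = 2 * j + 1" by auto
      with s' j fr rot show ?thesis
        by (auto simp: inner_diff_right inner_add_right block_entry_def rotation_entry_def)
    next
      case False
      then have "r \<noteq> 2 * j" "r \<noteq> 2 * j + 1" by auto
      with s' j False fr rot show ?thesis
        by (auto simp: inner_diff_right inner_add_right block_entry_def)
    qed
  qed
  moreover have "pos i < CARD('n)" for i using pos by (auto simp: bij_betw_def)
  ultimately show ?thesis
    by (simp add: vec_eq_iff frame_matrix_conj_entry block_diagonal_def)
qed

section \<open>Paths in the orthogonal group\<close>

text \<open>
  For a unit vector \<open>u\<close>, the reflection in the hyperplane orthogonal to \<open>u\<close>.
\<close>

definition householder :: "real^'n \<Rightarrow> real^'n^'n" where
  "householder u = (\<chi> i j. (if i = j then 1 else 0) - 2 * u $ i * u $ j)"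

lemma householder_mult: "householder u *v x = x - (2 * (u \<bullet> x)) *\<^sub>R u"
proof -
  have "(householder u *v x) $ i = (x - (2 * (u \<bullet> x)) *\<^sub>R u) $ i" for i
  proof -
    have "(householder u *v x) $ i = (\<Sum>j\<in>UNIV. (if i = j then x $ j else 0) - 2 * u $ i * (u $ j * x $ j))"
      unfolding householder_def matrix_vector_mult_def vec_lambda_beta
      by (rule sum.cong) (simp_all add: left_diff_distrib)
    also have "\<dots> = x $ i - 2 * u $ i * (u \<bullet> x)"
      by (simp add: sum_subtractf inner_vec_def flip: sum_distrib_left)
    finally show ?thesis by simp
  qed
  then show ?thesis by (simp add: vec_eq_iff)
qed

lemma householder_involution:
  assumes "norm u = 1" shows "householder u ** householder u = mat 1"
proof -
  have "householder u *v (householder u *v x) = x" for x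
    using assms unfolding householder_mult norm_eq_1 by (simp add: inner_diff_right)
  then show ?thesis by (simp add: matrix_eq flip: matrix_vector_mul_assoc)
qed

lemma orthogonal_householder:
  assumes "norm u = 1" shows "orthogonal_matrix (householder u)"
proof -
  have "transpose (householder u) = householder u"
    by (simp add: householder_def transpose_def vec_eq_iff)
  then show ?thesis using householder_involution[OF assms] by (simp add: orthogonal_matrix)
qed

abbreviation orthogonal_path :: "real^'n^'n \<Rightarrow> real^'n^'n \<Rightarrow> bool" where
  "orthogonal_path \<equiv> path_component (Collect orthogonal_matrix)"

lemma orthogonal_path_mult:
  assumes "orthogonal_path A B" "orthogonal_path C D"
  shows "orthogonal_path (A ** C) (B ** D)"
proof -
  obtain g h where gh: "path g" "path_image g \<subseteq> Collect orthogonal_matrix" "g 0 = A" "g 1 = B"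
     "path h" "path_image h \<subseteq> Collect orthogonal_matrix" "h 0 = C" "h 1 = D"
    using assms by (auto simp: path_component_def pathstart_def pathfinish_def)
  show ?thesis unfolding path_component_def
  proof (intro exI conjI)
    show "path (\<lambda>t. g t ** h t)"
      using gh(1,5) unfolding path_def by (rule bounded_bilinear.continuous_on[OF bounded_bilinear_matrix_mult])
    show "path_image (\<lambda>t. g t ** h t) \<subseteq> Collect orthogonal_matrix"
      using gh(2,6) by (auto simp: path_image_def intro!: orthogonal_matrix_mul)
  qed (use gh in \<open>auto simp: pathstart_def pathfinish_def\<close>)
qed

text \<open>
  The unit sphere is path-connected in dimension at least 2, so the mirror can be moved continuously.
\<close>

lemma orthogonal_path_householder:
  fixes u v :: "real^'n"
  assumes "CARD('n) \<ge> 2" "norm u = 1" "norm v = 1"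
  shows "orthogonal_path (householder u) (householder v)"
proof -
  have "path_connected (sphere (0 :: real^'n) 1)" using assms by (intro path_connected_sphere) simp
  then have "path_component (sphere 0 1) u v" using assms by (simp add: path_connected_component)
  then obtain g where g: "path g" "path_image g \<subseteq> sphere 0 1" "g 0 = u" "g 1 = v"
    by (auto simp: path_component_def pathstart_def pathfinish_def)
  show ?thesis unfolding path_component_def
  proof (intro exI conjI)
    show "path (\<lambda>t. householder (g t))"
      using g(1) unfolding path_def householder_def by (intro continuous_intros)
    show "path_image (\<lambda>t. householder (g t)) \<subseteq> Collect orthogonal_matrix"
      using g(2) by (auto simp: path_image_def intro!: orthogonal_householder)
  qed (use g in \<open>auto simp: pathstart_def pathfinish_def\<close>)
qed

lemma householder_swap:
  assumes "norm a = norm b" "a \<noteq> b"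
  shows "householder ((a - b) /\<^sub>R norm (a - b)) *v a = b"
proof -
  define d where "d = a - b"
  have "d \<bullet> d = 2 * (d \<bullet> a)"
    using assms(1) by (simp add: d_def norm_eq inner_diff_left inner_diff_right inner_commute)
  moreover have "d \<bullet> d \<noteq> 0" using assms(2) by (simp add: d_def)
  moreover have "norm d * norm d = d \<bullet> d"
    by (simp add: power2_norm_eq_inner flip: power2_eq_square)
  ultimately have "2 * (inverse (norm d) * (d \<bullet> a)) * inverse (norm d) = 1"
    by (simp add: field_simps)
  then have "(2 * ((d /\<^sub>R norm d) \<bullet> a)) *\<^sub>R (d /\<^sub>R norm d) = d"
    by (simp only: inner_scaleR_left scaleR_scaleR scaleR_one)
  then show ?thesis unfolding householder_mult by (simp add: d_def)
qed

text \<open>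
  Induction on the number of coordinate axes that \<open>P\<close> does not fix.  If \<open>P\<close> moves \<open>axis k\<close>, the
  reflection that exchanges \<open>axis k\<close> with its image composes with \<open>P\<close> to a matrix \<open>P'\<close> that fixes
  \<open>axis k\<close>.  The axes fixed by \<open>P\<close> stay fixed, because they are orthogonal to both \<open>axis k\<close> and
  its image.  Along a path this reflection may be replaced by \<open>householder e\<close>, and two copies of
  the latter cancel.
\<close>

lemma orthogonal_matrix_components:
  fixes P :: "real^'n^'n"
  assumes n: "CARD('n) \<ge> 2" and e: "norm e = 1" and "orthogonal_matrix P"
  shows "orthogonal_path (mat 1) P \<or> orthogonal_path (householder e) P"
  using assms(3)
proof (induction "card {k. P *v axis k 1 \<noteq> axis k 1}" arbitrary: P rule: less_induct)
  case less
  show ?case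
  proof (cases "\<forall>k. P *v axis k 1 = axis k 1")
    case True
    then have "P = mat 1" by (intro matrix_eq_on_axes) simp
    then show ?thesis by (simp add: path_component_refl orthogonal_matrix_id)
  next
    case False
    then obtain k where k: "P *v axis k 1 \<noteq> axis k 1" by blast
    have inner: "(P *v x) \<bullet> (P *v y) = x \<bullet> y" for x y
      by (rule orthogonal_matrix_inner[OF less.prems])
    define d where "d = P *v axis k 1 - axis k 1"
    define u where "u = d /\<^sub>R norm d"
    have u: "norm u = 1" using k by (simp add: u_def d_def)
    define P' where "P' = householder u ** P"
    have P: "P = householder u ** P'"
      using householder_involution[OF u] by (simp add: P'_def matrix_mul_assoc)
    have oP': "orthogonal_matrix P'"
      by (simp add: P'_def orthogonal_matrix_mul orthogonal_householder u less.prems)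
    have fix_k: "P' *v axis k 1 = axis k 1"
      unfolding P'_def matrix_vector_mul_assoc[symmetric] u_def d_def using k inner[of "axis k 1" "axis k 1"]
      by (intro householder_swap) (simp_all add: norm_eq_sqrt_inner)
    have fix_i: "P' *v axis i 1 = axis i 1" if i: "P *v axis i 1 = axis i 1" for i
    proof -
      have "i \<noteq> k" using i k by auto
      then have "d \<bullet> axis i 1 = 0"
        using inner[of "axis k 1" "axis i 1"] by (simp add: i d_def inner_diff_left inner_axis_axis)
      then show ?thesis by (simp add: P'_def matrix_vector_mul_assoc[symmetric] i householder_mult u_def)
    qed
    have "card {k. P' *v axis k 1 \<noteq> axis k 1} < card {k. P *v axis k 1 \<noteq> axis k 1}"
      using fix_k fix_i k by (intro psubset_card_mono) auto
    from less.hyps[OF this oP'] show ?thesis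
    proof
      assume "orthogonal_path (mat 1) P'"
      from orthogonal_path_mult[OF orthogonal_path_householder[OF n e u] this]
      show ?thesis by (simp flip: P)
    next
      assume "orthogonal_path (householder e) P'"
      from orthogonal_path_mult[OF orthogonal_path_householder[OF n e u] this]
      show ?thesis by (simp add: householder_involution[OF e] flip: P)
    qed
  qed
qed

section \<open>Ambient automorphisms by conjugation\<close>

text \<open>
  The circle is compact, so the inverse of a continuous injection is automatically continuous.
\<close>

lemma knotted_subgroup_compactI:
  fixes \<gamma> :: "complex \<Rightarrow> 'a::t2_space"
  assumes "\<gamma> \<in> hom circle_group G" "continuous_on (carrier circle_group) \<gamma>"
    "inj_on \<gamma> (carrier circle_group)"
  shows "knotted_subgroup G \<gamma>"
proof -
  have "compact (carrier circle_group)" by (simp add: circle_group_def)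
  then have "continuous_on (\<gamma> ` carrier circle_group) (inv_into (carrier circle_group) \<gamma>)"
    using assms(2,3) by (intro continuous_on_inv) auto
  with assms show ?thesis by (simp add: knotted_subgroup_def)
qed

lemma orthogonal_conj_inverse:
  assumes "orthogonal_matrix Q"
  shows "transpose Q ** (Q ** A ** transpose Q) ** Q = A" "Q ** (transpose Q ** A ** Q) ** transpose Q = A"
proof -
  have Q: "transpose Q ** Q = mat 1" "Q ** transpose Q = mat 1"
    using assms by (auto simp: orthogonal_matrix_def)
  have "transpose Q ** (Q ** A ** transpose Q) ** Q = (transpose Q ** Q) ** A ** (transpose Q ** Q)"
    by (simp only: matrix_mul_assoc)
  then show "transpose Q ** (Q ** A ** transpose Q) ** Q = A" by (simp add: Q)
  have "Q ** (transpose Q ** A ** Q) ** transpose Q = (Q ** transpose Q) ** A ** (Q ** transpose Q)"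
    by (simp only: matrix_mul_assoc)
  then show "Q ** (transpose Q ** A ** Q) ** transpose Q = A" by (simp add: Q)
qed

lemma orthogonal_conj_SO:
  assumes "orthogonal_matrix Q" "A \<in> carrier SO_group"
  shows "transpose Q ** A ** Q \<in> carrier SO_group" "Q ** A ** transpose Q \<in> carrier SO_group"
proof -
  have "det Q * det Q = 1"
    using assms(1) det_orthogonal_matrix[of Q] by auto
  then show "transpose Q ** A ** Q \<in> carrier SO_group" "Q ** A ** transpose Q \<in> carrier SO_group"
    using assms by (auto simp: SO_group_def det_mul orthogonal_matrix_mul orthogonal_matrix_transpose)
qed

lemma orthogonal_conj_hom:
  fixes Q :: "real^'n^'n"
  assumes "orthogonal_matrix Q"
  shows "(\<lambda>A. transpose Q ** A ** Q) \<in> hom SO_group SO_group"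
proof (rule homI)
  fix A B :: "real^'n^'n"
  show "transpose Q ** (A \<otimes>\<^bsub>SO_group\<^esub> B) ** Q =
      (transpose Q ** A ** Q) \<otimes>\<^bsub>SO_group\<^esub> (transpose Q ** B ** Q)"
  proof -
    have "(transpose Q ** A ** Q) ** (transpose Q ** B ** Q) = transpose Q ** A ** (Q ** transpose Q) ** B ** Q"
      by (simp only: matrix_mul_assoc)
    also have "\<dots> = transpose Q ** (A ** B) ** Q"
      using assms by (simp add: orthogonal_matrix_def matrix_mul_assoc)
    finally show ?thesis by (simp add: SO_group_def)
  qed
qed (rule orthogonal_conj_SO[OF assms])

lemma continuous_on_conj:
  fixes p q r :: "'a::topological_space \<Rightarrow> real^'n^'n"
  assumes "continuous_on S p" "continuous_on S q" "continuous_on S r"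
  shows "continuous_on S (\<lambda>x. p x ** q x ** r x)"
  using assms by (intro bounded_bilinear.continuous_on[OF bounded_bilinear_matrix_mult])

text \<open>
  Conjugation by the points \<open>g t\<close> of an orthogonal path from the identity to \<open>Q\<close> is the
  required isotopy of automorphisms.
\<close>

lemma ambient_automorphic_conj:
  fixes \<phi> :: "complex \<Rightarrow> real^'n^'n"
  assumes Q: "orthogonal_path (mat 1) Q" and \<phi>: "knotted_subgroup SO_group \<phi>"
  shows "ambient_automorphic SO_group \<phi> (\<lambda>z. transpose Q ** \<phi> z ** Q)"
proof -
  obtain g :: "real \<Rightarrow> real^'n^'n" where g': "path g" "path_image g \<subseteq> Collect orthogonal_matrix"
      "pathstart g = mat 1" "pathfinish g = Q"
    using Q unfolding path_component_def by blast
  then have g: "continuous_on {0..1} g" "\<And>t. t \<in> {0..1} \<Longrightarrow> orthogonal_matrix (g t)" "g 0 = mat 1" "g 1 = Q"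
    by (auto simp: path_def path_image_def pathstart_def pathfinish_def image_subset_iff)
  have oQ: "orthogonal_matrix Q" using g(2)[of 1] g(4) by simp
  define F where "F = (\<lambda>(A, t). transpose (g t) ** A ** g t)"
  have homeo: "homeomorphism (carrier SO_group) (carrier SO_group)
      (\<lambda>A. transpose (g t) ** A ** g t) (\<lambda>A. g t ** A ** transpose (g t))" if "t \<in> {0..1}" for t
  proof (rule homeomorphismI)
    note o = g(2)[OF that]
    show "continuous_on (carrier SO_group) (\<lambda>A. transpose (g t) ** A ** g t)"
      "continuous_on (carrier SO_group) (\<lambda>A. g t ** A ** transpose (g t))"
      by (intro continuous_on_conj continuous_on_const continuous_on_id)+
    show "(\<lambda>A. transpose (g t) ** A ** g t) ` carrier SO_group \<subseteq> carrier SO_group"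
      "(\<lambda>A. g t ** A ** transpose (g t)) ` carrier SO_group \<subseteq> carrier SO_group"
      using orthogonal_conj_SO[OF o] by blast+
    show "g t ** (transpose (g t) ** A ** g t) ** transpose (g t) = A"
      "transpose (g t) ** (g t ** A ** transpose (g t)) ** g t = A" for A
      by (rule orthogonal_conj_inverse[OF o])+
  qed
  have aut: "ambient_automorphism SO_group \<phi> (\<lambda>z. transpose Q ** \<phi> z ** Q) F"
    unfolding ambient_automorphism_def
  proof (intro conjI ballI)
    have "continuous_on (carrier SO_group \<times> {0..1}) (\<lambda>x :: (real^'n^'n) \<times> real. g (snd x))"
      by (rule continuous_on_compose2[OF g(1)]) (auto intro!: continuous_intros)
    then show "continuous_on (carrier SO_group \<times> {0..1}) F"
      unfolding F_def case_prod_beta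
      by (intro continuous_on_conj continuous_on_transpose continuous_on_fst continuous_on_id)
    show "F \<in> carrier SO_group \<times> {0..1} \<rightarrow> carrier SO_group"
      by (auto simp: F_def intro!: orthogonal_conj_SO g(2))
    show "F (A, 0) = A" for A by (simp add: F_def g(3))
    fix t :: real assume t: "t \<in> {0..1}"
    show "\<exists>h. homeomorphism (carrier SO_group) (carrier SO_group) (\<lambda>A. F (A, t)) h"
      using homeo[OF t] by (auto simp: F_def)
    show "(\<lambda>A. F (A, t)) \<in> iso SO_group SO_group"
      using orthogonal_conj_hom[OF g(2)[OF t]] homeo[OF t]
      unfolding homeomorphism_def iso_def F_def bij_betw_def
      by (auto intro: inj_on_inverseI[of _ "\<lambda>A. g t ** A ** transpose (g t)"])
  qed (simp add: F_def g(4))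
  have "knotted_subgroup SO_group (\<lambda>z. transpose Q ** \<phi> z ** Q)"
  proof (rule knotted_subgroup_compactI)
    show "(\<lambda>z. transpose Q ** \<phi> z ** Q) \<in> hom circle_group SO_group"
      using hom_compose[OF _ orthogonal_conj_hom[OF oQ], of \<phi>] \<phi> by (auto simp: knotted_subgroup_def o_def)
    show "continuous_on (carrier circle_group) (\<lambda>z. transpose Q ** \<phi> z ** Q)"
      using \<phi> by (intro continuous_on_conj continuous_on_const) (simp add: knotted_subgroup_def)
    show "inj_on (\<lambda>z. transpose Q ** \<phi> z ** Q) (carrier circle_group)"
    proof (rule inj_onI)
      fix z w assume zw: "z \<in> carrier circle_group" "w \<in> carrier circle_group"
        and "transpose Q ** \<phi> z ** Q = transpose Q ** \<phi> w ** Q"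
      then have "\<phi> z = \<phi> w" using orthogonal_conj_inverse(2)[OF oQ] by metis
      then show "z = w" using zw \<phi> by (simp add: knotted_subgroup_def inj_on_def)
    qed
  qed
  with \<phi> aut show ?thesis by (auto simp: ambient_automorphic_def)
qed

section \<open>Normal form of knotted subgroups\<close>

text \<open>
  Changing the sign of one frame vector is composition with a coordinate reflection, which
  exchanges the two components of the orthogonal group.
\<close>

lemma frame_matrix_flip:
  fixes pos :: "'n::finite \<Rightarrow> nat"
  assumes "inj pos"
  shows "frame_matrix pos (f(pos k := - f (pos k))) = frame_matrix pos f ** householder (axis k 1)"
proof (rule matrix_eq_on_axes)
  have col: "frame_matrix pos g *v axis i 1 = g (pos i)" for g i
    by (simp add: frame_matrix_def matrix_vector_mult_basis column_def vec_eq_iff)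
  show "frame_matrix pos (f(pos k := - f (pos k))) *v axis i 1 =
      (frame_matrix pos f ** householder (axis k 1)) *v axis i 1" for i
    using assms
    by (auto simp: matrix_vector_mul_assoc[symmetric] householder_mult inner_axis_axis
        matrix_vector_mult_diff_distrib matrix_vector_mult_scaleR col inj_eq scaleR_2)
qed

theorem theorem8:
  fixes \<phi> :: "complex \<Rightarrow> real^'n^'n" and pos :: "'n \<Rightarrow> nat"
  assumes "CARD('n) \<ge> 2"
    and "bij_betw pos UNIV {..<CARD('n)}"
    and "knotted_subgroup SO_group \<phi>"
  shows "\<exists>\<gamma>. knotted_subgroup SO_group \<gamma> \<and> ambient_automorphic SO_group \<phi> \<gamma> \<and>
           (\<exists>l lam. 1 \<le> l \<and> 2 * l \<le> CARD('n) \<and> (\<forall>j<l. lam j \<noteq> 0) \<and>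
                    (\<forall>t. \<gamma> (cis t) = block_diagonal pos l lam t))"
proof -
  note n = assms(1) and pos = assms(2) and \<phi> = assms(3)
  define A where "A = (\<lambda>t. \<phi> (cis t))"
  have cis: "cis t \<in> carrier circle_group" for t by (simp add: circle_group_def)
  have hom: "\<phi> \<in> hom circle_group SO_group" using \<phi> by (simp add: knotted_subgroup_def)
  have cont: "continuous_on UNIV A" unfolding A_def
    by (rule continuous_on_compose2[of "carrier circle_group" \<phi>])
       (use \<phi> cis in \<open>auto simp: knotted_subgroup_def intro!: continuous_intros\<close>)
  have add: "A (s + t) = A s ** A t" for s t
    using hom_mult[OF hom cis cis, of s t] by (simp add: A_def circle_group_def SO_group_def cis_mult)
  have zero: "A 0 = mat 1"
    using hom_one[OF hom group_circle_group group_SO_group] by (simp add: A_def circle_group_def SO_group_def)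
  have orth: "orthogonal_matrix (A t)" for t
    using hom_in_carrier[OF hom cis] by (simp add: A_def SO_group_def)
  obtain X where der: "\<And>t. (A has_vector_derivative A t ** X) (at t)"
    using one_parameter_group_generator[OF cont add zero] by blast
  obtain l lam f where l: "2 * l \<le> CARD('n)" and f: "orthonormal_upto CARD('n) f"
      and pairs: "rotation_pairs X l lam f" and ker: "\<And>i. 2 * l \<le> i \<Longrightarrow> i < CARD('n) \<Longrightarrow> X *v f i = 0"
    using skew_matrix_normal_form[OF generator_skew[OF der zero orth]] by metis
  have "l \<noteq> 0"
  proof
    assume "l = 0"
    have block: "transpose (frame_matrix pos f) ** A t ** frame_matrix pos f = block_diagonal pos l lam t" for t
      by (rule one_parameter_group_block_diagonal[OF pos der zero l f pairs ker])
    \<comment> \<open>Without blocks \<open>A\<close> is constant, and \<open>\<phi>\<close> takes the same value at \<open>1\<close> and \<open>-1\<close>.\<close>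
    have "block_diagonal pos 0 lam 0 = block_diagonal pos 0 lam pi"
      by (simp add: block_diagonal_def block_entry_def)
    then have "A 0 = A pi"
      using block[of 0] block[of pi] \<open>l = 0\<close> orthogonal_conj_inverse(2)[OF orthogonal_frame_matrix[OF pos f]]
      by metis
    then have "cis 0 = cis pi"
      using \<phi> cis unfolding A_def knotted_subgroup_def inj_on_def by blast
    then show False by simp
  qed
  \<comment> \<open>The column holding \<open>f 1\<close>, the second vector of the first rotation pair, whose sign may be changed.\<close>
  define k where "k = inv_into UNIV pos 1"
  have k: "pos k = 1"
    using pos n unfolding k_def by (intro f_inv_into_f) (auto simp: bij_betw_def)
  have inj: "inj pos" using pos by (simp add: bij_betw_def)
  have e: "norm (axis k 1 :: real^'n) = 1" by simp
  have "\<exists>f lam. orthonormal_upto CARD('n) f \<and> rotation_pairs X l lam f \<and>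
      (\<forall>i. 2 * l \<le> i \<longrightarrow> i < CARD('n) \<longrightarrow> X *v f i = 0) \<and> orthogonal_path (mat 1) (frame_matrix pos f)"
    using orthogonal_matrix_components[OF n e orthogonal_frame_matrix[OF pos f]]
  proof (elim disjE)
    assume "orthogonal_path (mat 1) (frame_matrix pos f)"
    then show ?thesis using f pairs ker by blast
  next
    let ?e = "axis k 1 :: real^'n"
    let ?f = "f(1 := - f 1)" and ?lam = "lam(0 := - lam 0)"
    \<comment> \<open>The frame lies in the component of the reflections; flipping \<open>f 1\<close> reverses the first rotation.\<close>
    assume "orthogonal_path (householder ?e) (frame_matrix pos f)"
    moreover have "orthogonal_path (householder ?e) (householder ?e)"
      by (simp add: path_component_refl orthogonal_householder)
    ultimately have "orthogonal_path (mat 1) (frame_matrix pos f ** householder ?e)"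
      by (metis orthogonal_path_mult householder_involution[OF e])
    then have "orthogonal_path (mat 1) (frame_matrix pos ?f)"
      using frame_matrix_flip[OF inj, of f k] k by simp
    moreover have "orthonormal_upto CARD('n) ?f"
      using f by (auto simp: orthonormal_upto_def)
    moreover have "rotation_pairs X l ?lam ?f"
      using pairs by (auto simp: rotation_pairs_def linear_neg[OF matrix_vector_mul_linear])
    moreover have "\<forall>i. 2 * l \<le> i \<longrightarrow> i < CARD('n) \<longrightarrow> X *v ?f i = 0"
      using ker \<open>l \<noteq> 0\<close> by auto
    ultimately show ?thesis by blast
  qed
  then obtain f lam where f: "orthonormal_upto CARD('n) f" and pairs: "rotation_pairs X l lam f"
    and ker: "\<And>i. 2 * l \<le> i \<Longrightarrow> i < CARD('n) \<Longrightarrow> X *v f i = 0"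
    and path: "orthogonal_path (mat 1) (frame_matrix pos f)" by blast
  define \<gamma> where "\<gamma> = (\<lambda>z. transpose (frame_matrix pos f) ** \<phi> z ** frame_matrix pos f)"
  have amb: "ambient_automorphic SO_group \<phi> \<gamma>"
    unfolding \<gamma>_def by (rule ambient_automorphic_conj[OF path \<phi>])
  have "\<gamma> (cis t) = block_diagonal pos l lam t" for t
    using one_parameter_group_block_diagonal[OF pos der zero l f pairs ker] by (simp add: \<gamma>_def A_def)
  moreover have "\<forall>j<l. lam j \<noteq> 0" using pairs by (simp add: rotation_pairs_def)
  ultimately show ?thesis
    using amb l \<open>l \<noteq> 0\<close> unfolding ambient_automorphic_def
    by (intro exI[of _ \<gamma>] conjI exI[of _ l] exI[of _ lam]) auto
qed

end
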